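(* Let $g\ge3$. The factorization $H(g)=(c_1c_2\cdots c_{2g}c_{2g+1}^2c_{2g}\cdots c_2c_1)^2$ of the identity in $\Gamma_g$ can be transformed by elementary transformations and simultaneous conjugations into a factorization containing, as a subword of consecutive letters, the product $c_3^2c_5^2\cdots c_{2g-1}^2c_{2g+1}^{2g-2}$ (the negative part of the daisy relator $D_{2(g-1)}$); explicitly, $H(g)$ is Hurwitz equivalent up to conjugation to ${}_{\varphi^{-2}}(\bar e_{2g})\cdots{}_{\varphi^{-2}}(\bar e_2)\,{}_{\varphi^{-2}}(d_{2g})\cdots{}_{\varphi^{-2}}(d_2)\,\bar d_2\bar d_4\cdots\bar d_{2g}\,e_2e_4\cdots e_{2g}\,c_1^2c_3^2\cdots c_{2g-1}^2\,c_{2g+1}^{2g+4}$. Hence a $D_{2(g-1)}$-substitution can be applied to it.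
   Context: $\Gamma_g$: mapping class group of closed genus-$g$ surface $\Sigma_g$. $c_1,\dots,c_{2g+1}$: standard chain of nonseparating curves on $\Sigma_g$; letters denote right-handed Dehn twists, ${}_f(x)=t_{f(x)}$. $\varphi=c_{2g+1}^{g+1}c_{2g-1}^{g}\cdots c_3^2c_1$; $d_i={}_{c_{i+1}}(c_i)$, $\bar d_i={}_{c_{i+1}^{-1}}(c_i)$, $e_{i+1}={}_{c_i}(c_{i+1})$, $\bar e_{i+1}={}_{c_i^{-1}}(c_{i+1})$. Daisy relation of type $p$: on a sphere with boundary curves $\delta_0,\dots,\delta_{p+1}$, $t_{\delta_0}^{p-1}t_{\delta_1}\cdots t_{\delta_{p+1}}=t_{x_1}\cdots t_{x_{p+1}}$ for interior curves $x_i$ in the standard daisy configuration ($x_i$ cobounds a pair of pants with $\delta_0,\delta_i$). $D_{2(g-1)}=c_3^{-2}c_5^{-2}\cdots c_{2g-1}^{-2}c_{2g+1}^{-(2g-2)}y_1y_2\cdots y_{2g-1}$ is the daisy relator of type $2(g-1)$ on a sphere with $2g$ holes embedded in $\Sigma_g$ whose central boundary is $c_{2g+1}$ and whose other boundaries are parallel copies of $c_{2g+1},c_{2g-1},\dots,c_3,c_3,\dots,c_{2g-1}$; here $y_1$ is a separating curve cutting off a genus-one subsurface, and $y_{g+1},\dots,y_{2g-1}$ coincide with the curves $x_2,\dots,x_g$ of the type-$(g-1)$ daisy relation $c_{2g+1}^{g-2}c_1c_3\cdots c_{2g-1}=x_1\cdots x_g$. A $D_{2(g-1)}$-substitution replaces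 the subword $c_3^2\cdots c_{2g-1}^2c_{2g+1}^{2g-2}$ by $y_1\cdots y_{2g-1}$. *)

theory Defs
  imports "HOL-Algebra.Group"
begin

text \<open>Functional (right-to-left) convention: the twist about f(x) is f t_x f^-1.\<close>
definition conjg :: "('a, 'b) monoid_scheme \<Rightarrow> 'a \<Rightarrow> 'a \<Rightarrow> 'a" where
  "conjg G f x = f \<otimes>\<^bsub>G\<^esub> x \<otimes>\<^bsub>G\<^esub> inv\<^bsub>G\<^esub> f"

definition prodl :: "('a, 'b) monoid_scheme \<Rightarrow> 'a list \<Rightarrow> 'a" where
  "prodl G xs = foldr (\<lambda>x y. x \<otimes>\<^bsub>G\<^esub> y) xs \<one>\<^bsub>G\<^esub>"

definition elem_transf :: "('a, 'b) monoid_scheme \<Rightarrow> 'a list \<Rightarrow> 'a list \<Rightarrow> bool" where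
  "elem_transf G xs ys \<longleftrightarrow> (\<exists>us a b vs. a \<in> carrier G \<and> b \<in> carrier G \<and>
      xs = us @ a # b # vs \<and> ys = us @ conjg G a b # a # vs)"

definition simul_conj :: "('a, 'b) monoid_scheme \<Rightarrow> 'a list \<Rightarrow> 'a list \<Rightarrow> bool" where
  "simul_conj G xs ys \<longleftrightarrow> (\<exists>h \<in> carrier G. ys = map (conjg G h) xs)"

definition hurwitz_equiv_conj :: "('a, 'b) monoid_scheme \<Rightarrow> 'a list \<Rightarrow> 'a list \<Rightarrow> bool" where
  "hurwitz_equiv_conj G xs ys \<longleftrightarrow> set xs \<subseteq> carrier G \<and>
     (\<lambda>u v. elem_transf G u v \<or> elem_transf G v u \<or> simul_conj G u v)\<^sup>*\<^sup>* xs ys"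

text \<open>The relations satisfied in Gamma_g by the Dehn twists c_1..c_{2g+1} about the standard
  chain (Birman--Hilden presentation of the hyperelliptic mapping class group).\<close>
definition chain_twists :: "('a, 'b) monoid_scheme \<Rightarrow> nat \<Rightarrow> (nat \<Rightarrow> 'a) \<Rightarrow> bool" where
  "chain_twists G g c \<longleftrightarrow>
     (\<forall>i \<in> {1..2*g+1}. c i \<in> carrier G) \<and>
     (\<forall>i \<in> {1..2*g+1}. \<forall>j \<in> {1..2*g+1}. i + 1 < j \<longrightarrow> c i \<otimes>\<^bsub>G\<^esub> c j = c j \<otimes>\<^bsub>G\<^esub> c i) \<and>
     (\<forall>i \<in> {1..2*g}. c i \<otimes>\<^bsub>G\<^esub> c (i+1) \<otimes>\<^bsub>G\<^esub> c i = c (i+1) \<otimes>\<^bsub>G\<^esub> c i \<otimes>\<^bsub>G\<^esub> c (i+1)) \<and>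
     prodl G (map c [1..<2*g+2]) [^]\<^bsub>G\<^esub> (2*g+2) = \<one>\<^bsub>G\<^esub> \<and>
     prodl G (map c [1..<2*g+2] @ rev (map c [1..<2*g+2])) [^]\<^bsub>G\<^esub> (2::nat) = \<one>\<^bsub>G\<^esub> \<and>
     c 1 \<otimes>\<^bsub>G\<^esub> prodl G (map c [1..<2*g+2] @ rev (map c [1..<2*g+2]))
       = prodl G (map c [1..<2*g+2] @ rev (map c [1..<2*g+2])) \<otimes>\<^bsub>G\<^esub> c 1"

definition Hg :: "nat \<Rightarrow> (nat \<Rightarrow> 'a) \<Rightarrow> 'a list" where
  "Hg g c = (let w = map c [1..<2*g+2] @ rev (map c [1..<2*g+2]) in w @ w)"

definition phi :: "('a, 'b) monoid_scheme \<Rightarrow> nat \<Rightarrow> (nat \<Rightarrow> 'a) \<Rightarrow> 'a" where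
  "phi G g c = prodl G (map (\<lambda>k. c (2*k+1) [^]\<^bsub>G\<^esub> (k+1)) (rev [0..<g+1]))"

definition dtw :: "('a, 'b) monoid_scheme \<Rightarrow> (nat \<Rightarrow> 'a) \<Rightarrow> nat \<Rightarrow> 'a" where
  "dtw G c i = conjg G (c (i+1)) (c i)"
definition dbar :: "('a, 'b) monoid_scheme \<Rightarrow> (nat \<Rightarrow> 'a) \<Rightarrow> nat \<Rightarrow> 'a" where
  "dbar G c i = conjg G (inv\<^bsub>G\<^esub> (c (i+1))) (c i)"
text \<open>e_{i+1} = t_{c_i}(c_{i+1}); indexed by j = i+1.\<close>
definition etw :: "('a, 'b) monoid_scheme \<Rightarrow> (nat \<Rightarrow> 'a) \<Rightarrow> nat \<Rightarrow> 'a" where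
  "etw G c j = conjg G (c (j-1)) (c j)"
definition ebar :: "('a, 'b) monoid_scheme \<Rightarrow> (nat \<Rightarrow> 'a) \<Rightarrow> nat \<Rightarrow> 'a" where
  "ebar G c j = conjg G (inv\<^bsub>G\<^esub> (c (j-1))) (c j)"

definition target :: "('a, 'b) monoid_scheme \<Rightarrow> nat \<Rightarrow> (nat \<Rightarrow> 'a) \<Rightarrow> 'a list" where
  "target G g c = (let p = inv\<^bsub>G\<^esub> (phi G g c [^]\<^bsub>G\<^esub> (2::nat)) in
     map (\<lambda>k. conjg G p (ebar G c (2*k))) (rev [1..<g+1]) @
     map (\<lambda>k. conjg G p (dtw G c (2*k))) (rev [1..<g+1]) @
     map (\<lambda>k. dbar G c (2*k)) [1..<g+1] @
     map (\<lambda>k. etw G c (2*k)) [1..<g+1] @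
     concat (map (\<lambda>k. [c (2*k-1), c (2*k-1)]) [1..<g+1]) @
     replicate (2*g+4) (c (2*g+1)))"

definition daisy_neg :: "nat \<Rightarrow> (nat \<Rightarrow> 'a) \<Rightarrow> 'a list" where
  "daisy_neg g c = concat (map (\<lambda>k. [c (2*k-1), c (2*k-1)]) [2..<g+1]) @
     replicate (2*g-2) (c (2*g+1))"

end

theory Submission
  imports Defs "HOL-Library.Multiset"
begin

text \<open>
  Put \<open>A = c\<^sub>1 \<cdots> c\<^sub>2\<^sub>g\<^sub>+\<^sub>1\<close>, let \<open>B\<close> be its reversal and \<open>P = c\<^sub>1 c\<^sub>3 \<cdots> c\<^sub>2\<^sub>g\<^sub>+\<^sub>1\<close>. The product of
  \<open>AB\<close> commutes with every \<open>c\<^sub>i\<close>, so \<open>ABAB\<close> becomes \<open>AABB\<close>. Sorting the odd letters out to the left or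
  to the right turns \<open>AA\<close> into \<open>P Y P\<close> with \<open>Y = \<Prod>dbar \<Prod>e\<close> and \<open>BB\<close> into \<open>P X P\<close> with
  \<open>X = \<Prod>ebar \<Prod>d\<close>, and a cyclic rotation, available because the total product is trivial, gives
  \<open>X P P Y P P\<close>. Pushing the inner \<open>P P\<close> to the left past \<open>X\<close> conjugates \<open>X\<close> by \<open>P\<^sup>-\<^sup>2\<close>; rotating it to
  the end yields \<open>X' Y P P P P\<close>. As conjugation by \<open>A\<close> maps \<open>c\<^sub>i\<close> to \<open>c\<^sub>i\<^sub>+\<^sub>1\<close>, conjugation by \<open>Y\<close> maps \<open>c\<^sub>k\<close>
  to \<open>c\<^sub>k\<^sub>+\<^sub>2\<close> for odd \<open>k\<close>. Hence a letter \<open>c\<^sub>k\<close> at the end can be moved left across \<open>Y\<close>, becoming \<open>c\<^sub>k\<^sub>+\<^sub>2\<close>,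
  then past \<open>X'\<close> (conjugating it) and back to the end. Raising two copies of every \<open>c\<^sub>k\<close> all the way to
  \<open>c\<^sub>2\<^sub>g\<^sub>+\<^sub>1\<close> accumulates exactly the conjugation by \<open>\<phi>\<^sup>-\<^sup>2\<close>.
\<close>

section \<open>Hurwitz moves on words\<close>

text \<open>Generated by elementary transformations and their inverses alone, so that a word keeps
  its exact product; cyclic rotation relies on this.\<close>

definition hurwitz_equiv :: "('a, 'b) monoid_scheme \<Rightarrow> 'a list \<Rightarrow> 'a list \<Rightarrow> bool" where
  "hurwitz_equiv G = (\<lambda>u v. elem_transf G u v \<or> elem_transf G v u)\<^sup>*\<^sup>*"

lemma hurwitz_equiv_refl [simp]: "hurwitz_equiv G xs xs"
  by (simp add: hurwitz_equiv_def)

lemma hurwitz_equiv_trans [trans]: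
  "hurwitz_equiv G xs ys \<Longrightarrow> hurwitz_equiv G ys zs \<Longrightarrow> hurwitz_equiv G xs zs"
  by (simp add: hurwitz_equiv_def)

lemma hurwitz_equiv_sym:
  assumes "hurwitz_equiv G xs ys" shows "hurwitz_equiv G ys xs"
proof -
  have "symp (\<lambda>u v. elem_transf G u v \<or> elem_transf G v u)"
    by (auto simp: symp_def)
  then show ?thesis
    using assms unfolding hurwitz_equiv_def by (meson symp_rtranclp sympD)
qed

lemma elem_transf_context:
  assumes "elem_transf G xs ys" shows "elem_transf G (us @ xs @ vs) (us @ ys @ vs)"
proof -
  obtain ps a b qs where "a \<in> carrier G" "b \<in> carrier G"
    "xs = ps @ a # b # qs" "ys = ps @ conjg G a b # a # qs"
    using assms unfolding elem_transf_def by blast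
  then show ?thesis
    unfolding elem_transf_def
    by (intro exI[of _ "us @ ps"] exI[of _ a] exI[of _ b] exI[of _ "qs @ vs"]) simp
qed

lemma hurwitz_equiv_context:
  assumes "hurwitz_equiv G xs ys" shows "hurwitz_equiv G (us @ xs @ vs) (us @ ys @ vs)"
  using assms unfolding hurwitz_equiv_def
proof induction
  case (step ys zs)
  have "elem_transf G (us @ ys @ vs) (us @ zs @ vs) \<or> elem_transf G (us @ zs @ vs) (us @ ys @ vs)"
    using step.hyps(2) elem_transf_context by blast
  with step.IH show ?case
    by (rule rtranclp.rtrancl_into_rtrancl)
qed simp

lemma hurwitz_equiv_append:
  assumes "hurwitz_equiv G xs ys" and "hurwitz_equiv G us vs"
  shows "hurwitz_equiv G (xs @ us) (ys @ vs)"
  using hurwitz_equiv_context[OF assms(1), of "[]" us] hurwitz_equiv_context[OF assms(2), of ys "[]"]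
    hurwitz_equiv_trans by fastforce

lemma hurwitz_equiv_Cons: "hurwitz_equiv G xs ys \<Longrightarrow> hurwitz_equiv G (a # xs) (a # ys)"
  using hurwitz_equiv_append[of G "[a]" "[a]" xs ys] by simp

lemma hurwitz_equiv_conj_if_hurwitz_equiv:
  assumes "set xs \<subseteq> carrier G" and "hurwitz_equiv G xs ys"
  shows "hurwitz_equiv_conj G xs ys"
  unfolding hurwitz_equiv_conj_def
  using assms mono_rtranclp[of "\<lambda>u v. elem_transf G u v \<or> elem_transf G v u"
    "\<lambda>u v. elem_transf G u v \<or> elem_transf G v u \<or> simul_conj G u v"]
  unfolding hurwitz_equiv_def by blast

lemma prodl_Nil [simp]: "prodl G [] = \<one>\<^bsub>G\<^esub>"
  and prodl_Cons [simp]: "prodl G (x # xs) = x \<otimes>\<^bsub>G\<^esub> prodl G xs"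
  by (simp_all add: prodl_def)

section \<open>Products, conjugation and commutation in a group\<close>

context group
begin

lemma prodl_closed [simp]: "set xs \<subseteq> carrier G \<Longrightarrow> prodl G xs \<in> carrier G"
  by (induction xs) auto

lemma prodl_append:
  "set xs \<subseteq> carrier G \<Longrightarrow> set ys \<subseteq> carrier G \<Longrightarrow> prodl G (xs @ ys) = prodl G xs \<otimes> prodl G ys"
  by (induction xs) (auto simp: m_assoc)

lemma conjg_closed [simp]: "f \<in> carrier G \<Longrightarrow> x \<in> carrier G \<Longrightarrow> conjg G f x \<in> carrier G"
  by (simp add: conjg_def)

lemma conjg_one [simp]: "x \<in> carrier G \<Longrightarrow> conjg G \<one> x = x"
  by (simp add: conjg_def)

lemma conjg_mult:
  "f \<in> carrier G \<Longrightarrow> h \<in> carrier G \<Longrightarrow> x \<in> carrier G \<Longrightarrow>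
    conjg G f (conjg G h x) = conjg G (f \<otimes> h) x"
  by (simp add: conjg_def m_assoc inv_mult_group)

lemma conjg_inv_conjg [simp]:
  "f \<in> carrier G \<Longrightarrow> x \<in> carrier G \<Longrightarrow> conjg G (inv f) (conjg G f x) = x"
  "f \<in> carrier G \<Longrightarrow> x \<in> carrier G \<Longrightarrow> conjg G f (conjg G (inv f) x) = x"
  by (simp_all add: conjg_mult)

lemma conjg_eq_iff:
  assumes "f \<in> carrier G" "x \<in> carrier G" "y \<in> carrier G"
  shows "conjg G f x = y \<longleftrightarrow> f \<otimes> x = y \<otimes> f"
  using assms unfolding conjg_def
  by (metis inv_solve_right' m_closed)

lemma conjg_inv_eq_iff:
  assumes "f \<in> carrier G" "x \<in> carrier G" "y \<in> carrier G"
  shows "conjg G (inv f) x = y \<longleftrightarrow> x \<otimes> f = f \<otimes> y"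
  using conjg_eq_iff[OF assms(1,3,2)] assms by (metis conjg_inv_conjg)

lemma commute_inv:
  assumes "x \<in> carrier G" "y \<in> carrier G" "x \<otimes> y = y \<otimes> x"
  shows "x \<otimes> inv y = inv y \<otimes> x"
  using assms by (metis conjg_eq_iff conjg_inv_eq_iff inv_closed)

lemma commute_mult:
  assumes "x \<in> carrier G" "y \<in> carrier G" "z \<in> carrier G" "x \<otimes> y = y \<otimes> x" "x \<otimes> z = z \<otimes> x"
  shows "x \<otimes> (y \<otimes> z) = (y \<otimes> z) \<otimes> x"
  using assms by (metis m_assoc)

lemma commute_conjg:
  assumes "x \<in> carrier G" "y \<in> carrier G" "z \<in> carrier G" "x \<otimes> y = y \<otimes> x" "x \<otimes> z = z \<otimes> x"
  shows "x \<otimes> conjg G y z = conjg G y z \<otimes> x"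
  unfolding conjg_def using assms by (intro commute_mult commute_inv) auto

lemma commute_prodl:
  assumes "x \<in> carrier G" "set ys \<subseteq> carrier G" "\<And>y. y \<in> set ys \<Longrightarrow> x \<otimes> y = y \<otimes> x"
  shows "x \<otimes> prodl G ys = prodl G ys \<otimes> x"
  using assms by (induction ys) (auto intro!: commute_mult)

section \<open>Moving letters and blocks by Hurwitz moves\<close>

lemma hurwitz_equiv_swap:
  assumes "a \<in> carrier G" "b \<in> carrier G"
  shows "hurwitz_equiv G [a, b] [conjg G a b, a]"
    and "hurwitz_equiv G [a, b] [b, conjg G (inv b) a]"
proof -
  have "elem_transf G [a, b] [conjg G a b, a]"
    unfolding elem_transf_def using assms
    by (intro exI[of _ "[]"] exI[of _ a] exI[of _ b]) simp
  then show "hurwitz_equiv G [a, b] [conjg G a b, a]"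
    unfolding hurwitz_equiv_def by blast
  have "elem_transf G [b, conjg G (inv b) a] [a, b]"
    unfolding elem_transf_def using assms
    by (intro exI[of _ "[]"] exI[of _ b] exI[of _ "conjg G (inv b) a"]) simp
  then show "hurwitz_equiv G [a, b] [b, conjg G (inv b) a]"
    unfolding hurwitz_equiv_def by blast
qed

text \<open>The product survives because \<open>conjg G a b\<close> times \<open>a\<close> equals
  \<open>a\<close> times \<open>b\<close>. The disjunction lets a move be used in either
  direction.\<close>

lemma prodl_elem_transf:
  assumes "elem_transf G xs ys" "set xs \<subseteq> carrier G \<or> set ys \<subseteq> carrier G"
  shows "set xs \<subseteq> carrier G \<and> set ys \<subseteq> carrier G \<and> prodl G xs = prodl G ys"
proof -
  obtain ps a b qs where ab: "a \<in> carrier G" "b \<in> carrier G"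
    and xs: "xs = ps @ a # b # qs" and ys: "ys = ps @ conjg G a b # a # qs"
    using assms unfolding elem_transf_def by blast
  then have sub: "set ps \<subseteq> carrier G" "set qs \<subseteq> carrier G"
    using assms(2) by auto
  have "conjg G a b \<otimes> a = a \<otimes> b"
    using conjg_eq_iff[of a b "conjg G a b"] ab by simp
  then have "conjg G a b \<otimes> (a \<otimes> prodl G qs) = a \<otimes> (b \<otimes> prodl G qs)"
    using ab sub by (simp flip: m_assoc)
  then show ?thesis
    using ab sub unfolding xs ys by (simp add: prodl_append)
qed

lemma hurwitz_equiv_prodl:
  assumes "hurwitz_equiv G xs ys" "set xs \<subseteq> carrier G"
  shows "set ys \<subseteq> carrier G \<and> prodl G ys = prodl G xs"
  using assms unfolding hurwitz_equiv_def
proof induction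
  case (step ys zs)
  then show ?case using prodl_elem_transf by metis
qed simp

text \<open>Each letter \<open>x\<close> that is passed conjugates the moving letter by
  \<open>inv x\<close>; the conjugators multiply up to the inverse of the whole product.\<close>

lemma hurwitz_equiv_move_right:
  assumes "a \<in> carrier G" "set xs \<subseteq> carrier G"
  shows "hurwitz_equiv G (a # xs) (xs @ [conjg G (inv (prodl G xs)) a])"
  using assms
proof (induction xs arbitrary: a)
  case (Cons x xs)
  have "hurwitz_equiv G (a # x # xs) (x # conjg G (inv x) a # xs)"
    using hurwitz_equiv_context[OF hurwitz_equiv_swap(2)[of a x], of "[]" xs] Cons.prems by simp
  also have "hurwitz_equiv G \<dots> (x # xs @ [conjg G (inv (prodl G xs)) (conjg G (inv x) a)])"
    using Cons by (intro hurwitz_equiv_Cons) simp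
  finally show ?case
    using Cons.prems by (simp add: conjg_mult inv_mult_group)
qed simp

lemma hurwitz_equiv_move_left:
  assumes "b \<in> carrier G" "set xs \<subseteq> carrier G"
  shows "hurwitz_equiv G (xs @ [b]) (conjg G (prodl G xs) b # xs)"
  using hurwitz_equiv_sym[OF hurwitz_equiv_move_right[of "conjg G (prodl G xs) b" xs]] assms
  by simp

text \<open>This uses the other of the two swaps: the moving letter stays as it is, and the letters
  it passes absorb the conjugation.\<close>

lemma hurwitz_equiv_move_left_conjg:
  assumes "b \<in> carrier G" "set xs \<subseteq> carrier G"
  shows "hurwitz_equiv G (xs @ [b]) (b # map (conjg G (inv b)) xs)"
  using assms
proof (induction xs)
  case (Cons x xs)
  have "hurwitz_equiv G (x # xs @ [b]) (x # b # map (conjg G (inv b)) xs)"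
    using Cons by (intro hurwitz_equiv_Cons) simp
  also have "hurwitz_equiv G \<dots> (b # conjg G (inv b) x # map (conjg G (inv b)) xs)"
    using hurwitz_equiv_context[OF hurwitz_equiv_swap(2)[of x b], of "[]"] Cons.prems by simp
  finally show ?case by simp
qed simp

lemma hurwitz_equiv_move_block_left_conjg:
  assumes "set ys \<subseteq> carrier G" "set xs \<subseteq> carrier G"
  shows "hurwitz_equiv G (xs @ ys) (ys @ map (conjg G (inv (prodl G ys))) xs)"
  using assms
proof (induction ys arbitrary: xs)
  case Nil
  have "map (conjg G \<one>) xs = xs"
    using Nil by (induction xs) auto
  then show ?case by simp
next
  case (Cons y ys)
  have "hurwitz_equiv G ((xs @ [y]) @ ys) ((y # map (conjg G (inv y)) xs) @ ys)"
    using Cons.prems by (intro hurwitz_equiv_append hurwitz_equiv_move_left_conjg) auto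
  also have "(y # map (conjg G (inv y)) xs) @ ys = y # (map (conjg G (inv y)) xs @ ys)"
    by simp
  also have "hurwitz_equiv G \<dots>
      (y # (ys @ map (conjg G (inv (prodl G ys))) (map (conjg G (inv y)) xs)))"
    using Cons.prems by (intro hurwitz_equiv_Cons Cons.IH) auto
  also have "map (conjg G (inv (prodl G ys))) (map (conjg G (inv y)) xs)
      = map (conjg G (inv (prodl G (y # ys)))) xs"
    using Cons.prems by (auto simp: conjg_mult inv_mult_group)
  finally show ?case by simp
qed

text \<open>When the product is trivial, the letters after the first letter \<open>x\<close>
  multiply to \<open>inv x\<close>. Moving \<open>x\<close> to the end therefore conjugates it by
  itself, which changes nothing.\<close>

lemma hurwitz_equiv_cyclic:
  assumes "set xs \<subseteq> carrier G" "set ys \<subseteq> carrier G" "prodl G (xs @ ys) = \<one>"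
  shows "hurwitz_equiv G (xs @ ys) (ys @ xs)"
  using assms
proof (induction xs arbitrary: ys)
  case (Cons x xs)
  have xs: "x \<in> carrier G" "set (xs @ ys) \<subseteq> carrier G" "prodl G (xs @ ys) \<in> carrier G"
    using Cons.prems by auto
  have "prodl G (xs @ ys) = inv x"
    using Cons.prems xs by (metis append_Cons inv_comm inv_equality prodl_Cons)
  then have "conjg G (inv (prodl G (xs @ ys))) x = x"
    using xs by (simp add: conjg_eq_iff)
  then have rot: "hurwitz_equiv G (x # (xs @ ys)) (xs @ (ys @ [x]))"
    using hurwitz_equiv_move_right[OF xs(1,2)] by simp
  moreover have "prodl G (xs @ (ys @ [x])) = \<one>"
    using hurwitz_equiv_prodl[OF rot] Cons.prems by auto
  ultimately show ?case
    using Cons.IH[of "ys @ [x]"] Cons.prems by (auto intro: hurwitz_equiv_trans)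
qed simp

text \<open>Only the product of \<open>ys\<close> has to commute with the letters of
  \<open>xs\<close>, since a letter crossing \<open>ys\<close> is conjugated by that product. This
  is what makes a central product useful.\<close>

lemma hurwitz_equiv_commute:
  assumes "set xs \<subseteq> carrier G" "set ys \<subseteq> carrier G"
    and "\<And>x. x \<in> set xs \<Longrightarrow> x \<otimes> prodl G ys = prodl G ys \<otimes> x"
  shows "hurwitz_equiv G (xs @ ys) (ys @ xs)"
  using assms
proof (induction xs)
  case (Cons x xs)
  have "hurwitz_equiv G (x # (xs @ ys)) (x # (ys @ xs))"
    using Cons by (intro hurwitz_equiv_Cons) auto
  also have "x # (ys @ xs) = (x # ys) @ xs"
    by simp
  also have "hurwitz_equiv G \<dots> ((ys @ [x]) @ xs)"
    using hurwitz_equiv_move_right[of x ys] conjg_inv_eq_iff[of "prodl G ys" x x] Cons.prems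
    by (intro hurwitz_equiv_append) auto
  finally show ?case by simp
qed simp

lemma hurwitz_equiv_commute_letters:
  assumes "set xs \<subseteq> carrier G" "set ys \<subseteq> carrier G"
    and "\<And>x y. x \<in> set xs \<Longrightarrow> y \<in> set ys \<Longrightarrow> x \<otimes> y = y \<otimes> x"
  shows "hurwitz_equiv G (xs @ ys) (ys @ xs)"
  using assms by (intro hurwitz_equiv_commute commute_prodl) auto

lemma hurwitz_equiv_permute:
  assumes "set xs \<subseteq> carrier G" "mset xs = mset ys"
    and "\<And>x y. x \<in> set xs \<Longrightarrow> y \<in> set xs \<Longrightarrow> x \<otimes> y = y \<otimes> x"
  shows "hurwitz_equiv G xs ys"
  using assms
proof (induction xs arbitrary: ys)
  case (Cons x xs)
  obtain us vs where ys: "ys = us @ x # vs"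
    using Cons.prems(2) by (metis list.set_intros(1) mset_eq_setD split_list)
  have m: "mset xs = mset (us @ vs)"
    using Cons.prems(2) ys by simp
  then have s: "set xs = set us \<union> set vs"
    by (metis mset_eq_setD set_append)
  have "hurwitz_equiv G (x # xs) (x # (us @ vs))"
    using Cons.prems m by (intro hurwitz_equiv_Cons Cons.IH) auto
  also have "x # (us @ vs) = ([x] @ us) @ vs"
    by simp
  also have "hurwitz_equiv G \<dots> ((us @ [x]) @ vs)"
    using Cons.prems s by (intro hurwitz_equiv_append hurwitz_equiv_commute_letters) auto
  finally show ?case using ys by simp
qed simp

text \<open>The letters \<open>a k\<close> change to \<open>a' k\<close> when they move left across \<open>Y\<close>, but not when they then
  pass \<open>X\<close>: there it is \<open>X\<close> that gets conjugated.\<close>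
lemma hurwitz_equiv_raise:
  assumes "set X \<subseteq> carrier G" "set Y \<subseteq> carrier G" "set W \<subseteq> carrier G"
    and "p \<in> carrier G" "\<And>k. k \<in> set ks \<Longrightarrow> a k \<in> carrier G \<and> a' k \<in> carrier G"
    and "\<And>k. k \<in> set ks \<Longrightarrow> prodl G Y \<otimes> a k = a' k \<otimes> prodl G Y"
    and "prodl G (map (conjg G p) X @ Y @ map a ks @ W) = \<one>"
  shows "hurwitz_equiv G (map (conjg G p) X @ Y @ map a ks @ W)
    (map (conjg G (inv (prodl G (map a' ks)) \<otimes> p)) X @ Y @ W @ map a' ks)"
proof -
  let ?X = "map (conjg G p) X" and ?X' = "map (conjg G (inv (prodl G (map a' ks)) \<otimes> p)) X"
  have [simp]: "conjg G p ` set X \<subseteq> carrier G"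
    using assms by auto
  have [simp]: "a ` set ks \<subseteq> carrier G" "a' ` set ks \<subseteq> carrier G"
    using assms(5) by auto
  have X': "map (conjg G (inv (prodl G (map a' ks)))) ?X = ?X'"
    using assms by (auto simp: conjg_mult)
  have X: "hurwitz_equiv G (?X @ map a' ks) (map a' ks @ ?X')"
    unfolding X'[symmetric] using assms
    by (intro hurwitz_equiv_move_block_left_conjg) auto
  have [simp]: "conjg G (inv (prodl G (map a' ks)) \<otimes> p) ` set X \<subseteq> carrier G"
    using assms by auto
  \<comment> \<open>A letter moved left across \<open>Y\<close> is conjugated by
    \<open>prodl G Y\<close>, which by assumption turns \<open>a k\<close> into
    \<open>a' k\<close>.\<close>
  have Y: "hurwitz_equiv G (Y @ map a ks) (map a' ks @ Y)"
    using assms(5,6)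
  proof (induction ks)
    case (Cons k ks)
    have "hurwitz_equiv G ((Y @ [a k]) @ map a ks) ((a' k # Y) @ map a ks)"
      using hurwitz_equiv_move_left[of "a k" Y] conjg_eq_iff[of "prodl G Y" "a k" "a' k"]
        Cons.prems assms(2) by (intro hurwitz_equiv_append) auto
    also have "hurwitz_equiv G \<dots> (a' k # (map a' ks @ Y))"
      using Cons by (auto intro!: hurwitz_equiv_Cons)
    finally show ?case by simp
  qed simp
  have "hurwitz_equiv G (?X @ (Y @ map a ks) @ W) (?X @ (map a' ks @ Y) @ W)"
    by (rule hurwitz_equiv_context[OF Y])
  also have "?X @ (map a' ks @ Y) @ W = (?X @ map a' ks) @ Y @ W"
    by simp
  also have "hurwitz_equiv G \<dots> ((map a' ks @ ?X') @ Y @ W)"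
    by (intro hurwitz_equiv_append X hurwitz_equiv_refl)
  finally have *: "hurwitz_equiv G (?X @ Y @ map a ks @ W) (map a' ks @ (?X' @ Y @ W))"
    by simp
  \<comment> \<open>Hurwitz moves have kept the product trivial, so the raised letters, now in
    front, may rotate to the end.\<close>
  also have "hurwitz_equiv G \<dots> ((?X' @ Y @ W) @ map a' ks)"
    using hurwitz_equiv_prodl[OF *] assms by (intro hurwitz_equiv_cyclic) auto
  finally show ?thesis by simp
qed

end

section \<open>Chains of braid generators\<close>

lemma mset_concat_map_append:
  "mset (concat (map (\<lambda>k. f k @ h k) xs)) = mset (concat (map f xs)) + mset (concat (map h xs))"
  by (induction xs) auto

lemma mset_concat_map_rev: "mset (concat (map f (rev xs))) = mset (concat (map f xs))"
  by (induction xs) auto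

text \<open>An index \<open>k\<close> below \<open>m\<close> lies in exactly the tails starting at
  0, ..., k. These k+1 occurrences are the source of the exponents in \<open>phi\<close>.\<close>

lemma mset_concat_upt_tails:
  "mset (concat (map (\<lambda>j. [j..<m]) [0..<m])) = mset (concat (map (\<lambda>k. replicate (k+1) k) [0..<m]))"
proof (induction m)
  case (Suc m)
  have const: "concat (map (\<lambda>_. [m]) [0..<l]) = replicate l m" for l
    by (induction l) (simp_all add: replicate_append_same)
  have "concat (map (\<lambda>j. [j..<Suc m]) [0..<Suc m])
      = concat (map (\<lambda>j. [j..<m] @ [m]) [0..<m]) @ [m]"
    by simp (intro arg_cong[of _ _ concat] map_cong, auto)
  then have "mset (concat (map (\<lambda>j. [j..<Suc m]) [0..<Suc m]))
      = mset (concat (map (\<lambda>j. [j..<m]) [0..<m])) + mset (replicate (m + 1) m)"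
    by (simp only: mset_append mset_concat_map_append const) simp
  then show ?case
    using Suc by simp
qed simp

lemma (in group) prodl_replicate: "x \<in> carrier G \<Longrightarrow> prodl G (replicate m x) = x [^] m"
proof (induction m)
  case (Suc m)
  then show ?case using nat_pow_Suc2[of x m] by simp
qed simp

text \<open>The letter \<open>a\<close> passes \<open>V\<close>, the braid relation trades it for a
  \<open>b\<close> on the left, and that \<open>b\<close> passes \<open>U\<close>. Arbitrary
  \<open>U\<close> and \<open>V\<close> let the lemma serve both the chain and its reversal.\<close>

lemma (in group) braid_slide:
  assumes "U \<in> carrier G" "V \<in> carrier G" "a \<in> carrier G" "b \<in> carrier G"
    and "a \<otimes> b \<otimes> a = b \<otimes> a \<otimes> b" "b \<otimes> U = U \<otimes> b" "a \<otimes> V = V \<otimes> a"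
  shows "U \<otimes> (a \<otimes> (b \<otimes> V)) \<otimes> a = b \<otimes> (U \<otimes> (a \<otimes> (b \<otimes> V)))"
proof -
  have "U \<otimes> (a \<otimes> (b \<otimes> V)) \<otimes> a = U \<otimes> (a \<otimes> b \<otimes> (V \<otimes> a))"
    using assms(1-4) by (simp add: m_assoc)
  also have "\<dots> = U \<otimes> ((a \<otimes> b \<otimes> a) \<otimes> V)"
    using assms(1-4) by (simp add: m_assoc flip: assms(7))
  also have "\<dots> = (U \<otimes> b) \<otimes> (a \<otimes> (b \<otimes> V))"
    unfolding assms(5) using assms(1-4) by (simp add: m_assoc)
  also have "\<dots> = b \<otimes> (U \<otimes> (a \<otimes> (b \<otimes> V)))"
    using assms(1-4) by (simp add: m_assoc flip: assms(6))
  finally show ?thesis .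
qed

section \<open>Braid relations and index shifts along a chain\<close>

locale braid_chain = group G for G (structure) +
  fixes n :: nat and c :: "nat \<Rightarrow> 'a"
  assumes c_closed [simp]: "1 \<le> i \<Longrightarrow> i \<le> n \<Longrightarrow> c i \<in> carrier G"
    and c_commute: "1 \<le> i \<Longrightarrow> i + 1 < j \<Longrightarrow> j \<le> n \<Longrightarrow> c i \<otimes> c j = c j \<otimes> c i"
    and c_braid: "1 \<le> i \<Longrightarrow> i < n \<Longrightarrow> c i \<otimes> c (i+1) \<otimes> c i = c (i+1) \<otimes> c i \<otimes> c (i+1)"
begin

lemma c_far_commute:
  assumes "1 \<le> i" "i \<le> n" "1 \<le> j" "j \<le> n" "i + 1 < j \<or> j + 1 < i \<or> i = j"
  shows "c i \<otimes> c j = c j \<otimes> c i"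
  using assms c_commute[of i j] c_commute[of j i] by auto

lemma c_odd_commute:
  assumes "2*i+1 \<le> n" "2*j+1 \<le> n" shows "c (2*i+1) \<otimes> c (2*j+1) = c (2*j+1) \<otimes> c (2*i+1)"
  using assms by (intro c_far_commute) auto

lemma upt_split_two: "1 \<le> i \<Longrightarrow> i < n \<Longrightarrow> [1..<n+1] = [1..<i] @ i # (i+1) # [i+2..<n+1]"
  using upt_add_eq_append[of 1 i "n+1-i"] by (simp add: upt_conv_Cons)

lemma prodl_chain_shift:
  assumes "1 \<le> i" "i < n"
  shows "prodl G (map c [1..<n+1]) \<otimes> c i = c (i+1) \<otimes> prodl G (map c [1..<n+1])"
proof -
  let ?U = "map c [1..<i]" and ?V = "map c [i+2..<n+1]"
  have sub: "set ?U \<subseteq> carrier G" "set ?V \<subseteq> carrier G"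
    using assms by auto
  have "prodl G (map c [1..<n+1]) = prodl G ?U \<otimes> (c i \<otimes> (c (i+1) \<otimes> prodl G ?V))"
    unfolding upt_split_two[OF assms] using assms sub by (simp add: prodl_append)
  moreover have "c (i+1) \<otimes> prodl G ?U = prodl G ?U \<otimes> c (i+1)"
    using assms sub by (intro commute_prodl) (auto intro!: c_far_commute)
  moreover have "c i \<otimes> prodl G ?V = prodl G ?V \<otimes> c i"
    using assms sub by (intro commute_prodl) (auto intro!: c_far_commute)
  ultimately show ?thesis
    using assms sub c_braid[OF assms] by (simp add: braid_slide)
qed

text \<open>In the reversed chain \<open>c (i+1)\<close> plays the part of \<open>a\<close> and
  \<open>c i\<close> that of \<open>b\<close> in \<open>braid_slide\<close>, so indices go down
  instead of up.\<close>

lemma prodl_rev_chain_shift: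
  assumes "1 \<le> i" "i < n"
  shows "prodl G (rev (map c [1..<n+1])) \<otimes> c (i+1) = c i \<otimes> prodl G (rev (map c [1..<n+1]))"
proof -
  let ?U = "rev (map c [1..<i])" and ?V = "rev (map c [i+2..<n+1])"
  have sub: "set ?U \<subseteq> carrier G" "set ?V \<subseteq> carrier G"
    using assms by auto
  have "prodl G (rev (map c [1..<n+1])) = prodl G ?V \<otimes> (c (i+1) \<otimes> (c i \<otimes> prodl G ?U))"
    unfolding upt_split_two[OF assms] using assms sub by (simp add: prodl_append)
  moreover have "c (i+1) \<otimes> prodl G ?U = prodl G ?U \<otimes> c (i+1)"
    using assms sub by (intro commute_prodl) (auto intro!: c_far_commute)
  moreover have "c i \<otimes> prodl G ?V = prodl G ?V \<otimes> c i"
    using assms sub by (intro commute_prodl) (auto intro!: c_far_commute)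
  ultimately show ?thesis
    using assms sub c_braid[OF assms] by (simp add: braid_slide)
qed

section \<open>Sorting the odd letters out of a chain\<close>

lemma twist_conjugates_closed:
  assumes "1 \<le> k" "2*k+1 \<le> n"
  shows "dtw G c (2*k) \<in> carrier G" "dbar G c (2*k) \<in> carrier G"
    "etw G c (2*k) \<in> carrier G" "ebar G c (2*k) \<in> carrier G"
  using assms by (auto simp: dtw_def dbar_def etw_def ebar_def intro!: conjg_closed)

lemma c_commute_dtw:
  assumes "1 \<le> k" "2*k+2 < j" "j \<le> n"
  shows "c j \<otimes> dtw G c (2*k) = dtw G c (2*k) \<otimes> c j"
    and "c j \<otimes> dbar G c (2*k) = dbar G c (2*k) \<otimes> c j"
  using assms unfolding dtw_def dbar_def
  by (auto intro!: commute_conjg commute_inv c_far_commute)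

lemma c_commute_etw:
  assumes "1 \<le> j" "j + 2 < 2*k" "2*k \<le> n"
  shows "c j \<otimes> etw G c (2*k) = etw G c (2*k) \<otimes> c j"
    and "c j \<otimes> ebar G c (2*k) = ebar G c (2*k) \<otimes> c j"
  using assms unfolding etw_def ebar_def
  by (auto intro!: commute_conjg commute_inv c_far_commute)

text \<open>Each new pair \<open>c (2*m+2)\<close>, \<open>c (2*m+3)\<close> is swapped, which
  creates \<open>dbar G c (2*m+2)\<close>; the odd letter then commutes with all earlier
  \<open>dbar\<close> letters and joins the other odd ones on the left.\<close>

lemma chain_to_odd_dbar:
  "2*m+1 \<le> n \<Longrightarrow> hurwitz_equiv G (map c [1..<2*m+2])
    (map (\<lambda>k. c (2*k+1)) [0..<m+1] @ map (\<lambda>k. dbar G c (2*k)) [1..<m+1])"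
proof (induction m)
  case (Suc m)
  let ?P = "map (\<lambda>k. c (2*k+1)) [0..<m+1]" and ?D = "map (\<lambda>k. dbar G c (2*k)) [1..<m+1]"
  have "map c [1..<2*Suc m+2] = map c [1..<2*m+2] @ [c (2*m+2), c (2*m+3)]"
    by (simp add: numeral_eq_Suc)
  also have "hurwitz_equiv G \<dots> ((?P @ ?D) @ [c (2*m+3), dbar G c (2*m+2)])"
    using Suc hurwitz_equiv_swap(2)[of "c (2*m+2)" "c (2*m+3)"]
    by (intro hurwitz_equiv_append) (auto simp: dbar_def numeral_eq_Suc)
  also have "(?P @ ?D) @ [c (2*m+3), dbar G c (2*m+2)]
      = ?P @ (?D @ [c (2*m+3)]) @ [dbar G c (2*m+2)]"
    by simp
  also have "hurwitz_equiv G \<dots> (?P @ ([c (2*m+3)] @ ?D) @ [dbar G c (2*m+2)])"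
    using Suc.prems
    by (intro hurwitz_equiv_context hurwitz_equiv_commute_letters)
      (auto simp: twist_conjugates_closed c_commute_dtw)
  also have "\<dots> = map (\<lambda>k. c (2*k+1)) [0..<Suc m+1] @ map (\<lambda>k. dbar G c (2*k)) [1..<Suc m+1]"
    by (simp add: numeral_eq_Suc)
  finally show ?case .
qed simp

text \<open>Here the new even letter moves instead: it crosses \<open>c (2*m+1)\<close>, becoming
  \<open>etw G c (2*m+2)\<close>, and commutes with the smaller odd letters.\<close>

lemma chain_to_etw_odd:
  "2*m+1 \<le> n \<Longrightarrow> hurwitz_equiv G (map c [1..<2*m+2])
    (map (\<lambda>k. etw G c (2*k)) [1..<m+1] @ map (\<lambda>k. c (2*k+1)) [0..<m+1])"
proof (induction m)
  case (Suc m)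
  let ?P = "map (\<lambda>k. c (2*k+1)) [0..<m]" and ?E = "map (\<lambda>k. etw G c (2*k)) [1..<m+1]"
  have "map c [1..<2*Suc m+2] = map c [1..<2*m+2] @ [c (2*m+2), c (2*m+3)]"
    by (simp add: numeral_eq_Suc)
  also have "hurwitz_equiv G \<dots>
      ((?E @ map (\<lambda>k. c (2*k+1)) [0..<m+1]) @ [c (2*m+2), c (2*m+3)])"
    using Suc by (intro hurwitz_equiv_append) auto
  also have "\<dots> = (?E @ ?P) @ [c (2*m+1), c (2*m+2)] @ [c (2*m+3)]"
    by simp
  also have "hurwitz_equiv G \<dots> ((?E @ ?P) @ [etw G c (2*m+2), c (2*m+1)] @ [c (2*m+3)])"
    using Suc.prems hurwitz_equiv_swap(1)[of "c (2*m+1)" "c (2*m+2)"]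
    by (intro hurwitz_equiv_context) (auto simp: etw_def numeral_eq_Suc)
  also have "\<dots> = ?E @ (?P @ [etw G c (2*m+2)]) @ [c (2*m+1), c (2*m+3)]"
    by simp
  also have "hurwitz_equiv G \<dots> (?E @ ([etw G c (2*m+2)] @ ?P) @ [c (2*m+1), c (2*m+3)])"
    using Suc.prems twist_conjugates_closed[of "m+1"] c_commute_etw[of _ "m+1"]
    by (intro hurwitz_equiv_context hurwitz_equiv_commute_letters) auto
  also have "\<dots> = map (\<lambda>k. etw G c (2*k)) [1..<Suc m+1] @ map (\<lambda>k. c (2*k+1)) [0..<Suc m+1]"
    by (simp add: numeral_eq_Suc)
  finally show ?case .
qed simp

text \<open>As for \<open>dbar\<close>, but the new pair stands in front in reversed order: the odd
  letter crosses its even neighbour and then commutes past the older \<open>dtw\<close> letters to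
  the right.\<close>

lemma rev_chain_to_dtw_odd:
  "2*m+1 \<le> n \<Longrightarrow> hurwitz_equiv G (rev (map c [1..<2*m+2]))
    (map (\<lambda>k. dtw G c (2*k)) (rev [1..<m+1]) @ map (\<lambda>k. c (2*k+1)) (rev [0..<m+1]))"
proof (induction m)
  case (Suc m)
  let ?P = "map (\<lambda>k. c (2*k+1)) (rev [0..<m+1])" and ?D = "map (\<lambda>k. dtw G c (2*k)) (rev [1..<m+1])"
  have "rev (map c [1..<2*Suc m+2]) = [c (2*m+3), c (2*m+2)] @ rev (map c [1..<2*m+2])"
    by (simp add: numeral_eq_Suc)
  also have "hurwitz_equiv G \<dots> ([dtw G c (2*m+2), c (2*m+3)] @ (?D @ ?P))"
    using Suc hurwitz_equiv_swap(1)[of "c (2*m+3)" "c (2*m+2)"]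
    by (intro hurwitz_equiv_append) (auto simp: dtw_def numeral_eq_Suc)
  also have "\<dots> = [dtw G c (2*m+2)] @ ([c (2*m+3)] @ ?D) @ ?P"
    by simp
  also have "hurwitz_equiv G \<dots> ([dtw G c (2*m+2)] @ (?D @ [c (2*m+3)]) @ ?P)"
    using Suc.prems
    by (intro hurwitz_equiv_context hurwitz_equiv_commute_letters)
      (auto simp: twist_conjugates_closed c_commute_dtw)
  also have "\<dots> = map (\<lambda>k. dtw G c (2*k)) (rev [1..<Suc m+1]) @ map (\<lambda>k. c (2*k+1)) (rev [0..<Suc m+1])"
    by (simp add: numeral_eq_Suc)
  finally show ?case .
qed simp

text \<open>As for \<open>etw\<close>, but the even letter moves right, across
  \<open>c (2*m+1)\<close> and then past the smaller odd letters.\<close>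

lemma rev_chain_to_odd_ebar:
  "2*m+1 \<le> n \<Longrightarrow> hurwitz_equiv G (rev (map c [1..<2*m+2]))
    (map (\<lambda>k. c (2*k+1)) (rev [0..<m+1]) @ map (\<lambda>k. ebar G c (2*k)) (rev [1..<m+1]))"
proof (induction m)
  case (Suc m)
  let ?P = "map (\<lambda>k. c (2*k+1)) (rev [0..<m])" and ?E = "map (\<lambda>k. ebar G c (2*k)) (rev [1..<m+1])"
  have "rev (map c [1..<2*Suc m+2]) = [c (2*m+3), c (2*m+2)] @ rev (map c [1..<2*m+2])"
    by (simp add: numeral_eq_Suc)
  also have "hurwitz_equiv G \<dots>
      ([c (2*m+3), c (2*m+2)] @ map (\<lambda>k. c (2*k+1)) (rev [0..<m+1]) @ ?E)"
    using Suc by (intro hurwitz_equiv_append) auto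
  also have "\<dots> = [c (2*m+3)] @ [c (2*m+2), c (2*m+1)] @ ?P @ ?E"
    by simp
  also have "hurwitz_equiv G \<dots> ([c (2*m+3)] @ [c (2*m+1), ebar G c (2*m+2)] @ ?P @ ?E)"
    using Suc.prems hurwitz_equiv_swap(2)[of "c (2*m+2)" "c (2*m+1)"]
    by (intro hurwitz_equiv_context) (auto simp: ebar_def numeral_eq_Suc)
  also have "\<dots> = [c (2*m+3), c (2*m+1)] @ ([ebar G c (2*m+2)] @ ?P) @ ?E"
    by simp
  also have "hurwitz_equiv G \<dots> ([c (2*m+3), c (2*m+1)] @ (?P @ [ebar G c (2*m+2)]) @ ?E)"
    using Suc.prems twist_conjugates_closed[of "m+1"] c_commute_etw[of _ "m+1"]
    by (intro hurwitz_equiv_context hurwitz_equiv_commute_letters) (auto simp flip: c_commute_etw)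
  also have "\<dots> = map (\<lambda>k. c (2*k+1)) (rev [0..<Suc m+1]) @ map (\<lambda>k. ebar G c (2*k)) (rev [1..<Suc m+1])"
    by (simp add: numeral_eq_Suc)
  finally show ?case .
qed simp

section \<open>Odd letters and the exponents of \<open>phi\<close>\<close>

lemma hurwitz_equiv_permute_odd:
  assumes "mset ks = mset ls" "\<And>k. k \<in> set ks \<Longrightarrow> 2*k+1 \<le> n"
  shows "hurwitz_equiv G (map (\<lambda>k. c (2*k+1)) ks) (map (\<lambda>k. c (2*k+1)) ls)"
  using assms c_odd_commute by (intro hurwitz_equiv_permute) auto

lemma phi_eq_prodl:
  assumes "2*g+1 \<le> n"
  shows "phi G g c
    = prodl G (map (\<lambda>k. c (2*k+1)) (concat (map (\<lambda>k. replicate (k+1) k) (rev [0..<g+1]))))"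
proof -
  have *: "prodl G (map (\<lambda>k. c (2*k+1) [^] (k+1)) ks)
      = prodl G (map (\<lambda>k. c (2*k+1)) (concat (map (\<lambda>k. replicate (k+1) k) ks)))"
    if "\<And>k. k \<in> set ks \<Longrightarrow> 2*k+1 \<le> n" for ks
    using that
  proof (induction ks)
    case (Cons k ks)
    then have "prodl G (replicate (k+1) (c (2*k+1))) = c (2*k+1) [^] (k+1)"
      by (intro prodl_replicate) simp
    moreover have "set (replicate (k+1) (c (2*k+1))) \<subseteq> carrier G"
      "set (map (\<lambda>k. c (2*k+1)) (concat (map (\<lambda>k. replicate (k+1) k) ks))) \<subseteq> carrier G"
      using Cons.prems by auto
    ultimately show ?case
      using Cons.IH Cons.prems
      by (simp add: prodl_append del: replicate_Suc nat_pow_Suc)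
  qed simp
  show ?thesis
    unfolding phi_def by (rule *) (use assms in auto)
qed

text \<open>The word lists the letters that pass \<open>X\<close> over all stages: two copies of
  each tail \<open>[i..<g+1]\<close>. The index \<open>k\<close> occurs 2(k+1) times, twice its
  exponent in \<open>phi\<close>, and odd letters commute.\<close>

lemma prodl_tails_eq_phi_square:
  assumes "2*g+1 \<le> n"
  shows "prodl G (map (\<lambda>k. c (2*k+1)) (concat (map (\<lambda>i. [i..<g+1] @ [i..<g+1]) [0..<g+1])))
    = phi G g c [^] (2::nat)"
proof -
  let ?L = "concat (map (\<lambda>i. [i..<g+1] @ [i..<g+1]) [0..<g+1])"
  let ?R = "concat (map (\<lambda>k. replicate (k+1) k) (rev [0..<g+1]))"
  have "mset ?L = mset (?R @ ?R)"
    by (simp only: mset_append mset_concat_map_append mset_concat_map_rev mset_concat_upt_tails)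
  moreover have "2*k+1 \<le> n" if "k \<in> set ?L" for k
    using that assms by (auto simp del: upt_Suc)
  ultimately have perm: "hurwitz_equiv G (map (\<lambda>k. c (2*k+1)) ?L) (map (\<lambda>k. c (2*k+1)) (?R @ ?R))"
    by (rule hurwitz_equiv_permute_odd)
  have L: "set (map (\<lambda>k. c (2*k+1)) ?L) \<subseteq> carrier G"
    using assms by auto
  have "prodl G (map (\<lambda>k. c (2*k+1)) ?L) = prodl G (map (\<lambda>k. c (2*k+1)) (?R @ ?R))"
    using hurwitz_equiv_prodl[OF perm L] by (simp only:)
  moreover have R: "set (map (\<lambda>k. c (2*k+1)) ?R) \<subseteq> carrier G"
    using assms by auto
  ultimately show ?thesis
    unfolding phi_eq_prodl[OF assms] map_append prodl_append[OF R R]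
    using prodl_closed[OF R] by (simp add: numeral_2_eq_2)
qed

text \<open>At stage \<open>j\<close> the moving copies have been raised to the indices \<open>j, \<dots>, g\<close>.\<close>
lemma hurwitz_equiv_raise_odd:
  assumes g: "2*g+1 \<le> n" and sub: "set X \<subseteq> carrier G" "set Y \<subseteq> carrier G"
    and shift: "\<And>k. k < g \<Longrightarrow> prodl G Y \<otimes> c (2*k+1) = c (2*Suc k+1) \<otimes> prodl G Y"
    and state: "\<And>j. state j =
      map (conjg G (inv (prodl G (map (\<lambda>k. c (2*k+1))
        (concat (map (\<lambda>i. [i..<g+1] @ [i..<g+1]) [0..<Suc j])))))) X @ Y @
      map (\<lambda>k. c (2*k+1)) ([0..<g] @ [0..<g] @ [j..<g+1] @ [j..<g+1] @ replicate (2+2*j) g)"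
    and one: "prodl G (state 0) = \<one>"
  shows "j \<le> g \<Longrightarrow> hurwitz_equiv G (state 0) (state j)"
proof (induction j)
  case (Suc j)
  let ?o = "map (\<lambda>k. c (2*k+1))"
  let ?L = "concat (map (\<lambda>i. [i..<g+1] @ [i..<g+1]) [0..<Suc j])"
  let ?p = "inv (prodl G (?o ?L))"
  \<comment> \<open>Only indices below \<open>g\<close> can still be raised, as
    \<open>c (2*g+1)\<close> is the last letter. The two copies of \<open>g\<close> ending the tails
    therefore join the resting letters, hence the two extra \<open>Suc\<close>.\<close>
  let ?ks = "[j..<g] @ [j..<g]" and ?ls = "[0..<g] @ [0..<g] @ replicate (Suc (Suc (2+2*j))) g"
  let ?ks' = "[Suc j..<g+1] @ [Suc j..<g+1]"
  have sL: "set (?o ?L) \<subseteq> carrier G" and sks': "set (?o ?ks') \<subseteq> carrier G"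
    using g Suc.prems by auto
  note closed = prodl_closed[OF sL] prodl_closed[OF sks']
  have IH: "hurwitz_equiv G (state 0) (state j)"
    using Suc by simp
  have s0: "set (state 0) \<subseteq> carrier G"
  proof -
    have "set (?o (concat (map (\<lambda>i. [i..<g+1] @ [i..<g+1]) [0..<Suc 0]))) \<subseteq> carrier G"
      using g by auto
    note prodl_closed[OF this]
    then show ?thesis
      unfolding state using sub g by auto
  qed
  have "hurwitz_equiv G ((map (conjg G ?p) X @ Y)
        @ ?o ([0..<g] @ [0..<g] @ [j..<g+1] @ [j..<g+1] @ replicate (2+2*j) g))
      ((map (conjg G ?p) X @ Y) @ ?o (?ks @ ?ls))"
    using Suc.prems g
    by (intro hurwitz_equiv_append[OF hurwitz_equiv_refl] hurwitz_equiv_permute_odd) auto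
  then have 1: "hurwitz_equiv G (state j) (map (conjg G ?p) X @ Y @ ?o ?ks @ ?o ?ls)"
    by (simp only: state append_assoc map_append)
  have one': "prodl G (map (conjg G ?p) X @ Y @ ?o ?ks @ ?o ?ls) = \<one>"
    using hurwitz_equiv_prodl[OF hurwitz_equiv_trans[OF IH 1] s0] one by (simp only:)
  have letters: "set (?o ?ls) \<subseteq> carrier G"
    "\<And>k. k \<in> set ?ks \<Longrightarrow> c (2*k+1) \<in> carrier G \<and> c (2*Suc k+1) \<in> carrier G"
    "\<And>k. k \<in> set ?ks \<Longrightarrow> prodl G Y \<otimes> c (2*k+1) = c (2*Suc k+1) \<otimes> prodl G Y"
    using g shift by auto
  have ks': "map (\<lambda>k. c (2*Suc k+1)) ?ks = ?o ?ks'"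
  proof -
    have "map Suc ?ks = ?ks'"
      by (simp add: map_Suc_upt del: upt_Suc)
    then have "?o (map Suc ?ks) = ?o ?ks'"
      by (rule arg_cong)
    then show ?thesis
      by (simp only: map_map o_def)
  qed
  have L': "?o (concat (map (\<lambda>i. [i..<g+1] @ [i..<g+1]) [0..<Suc (Suc j)])) = ?o ?L @ ?o ?ks'"
    by simp
  \<comment> \<open>The new conjugator multiplies on the left, so inside the inverse its letters are
    appended on the right.\<close>
  have p': "inv (prodl G (?o ?ks')) \<otimes> ?p = inv (prodl G (?o ?L @ ?o ?ks'))"
    using closed by (simp only: prodl_append[OF sL sks'] inv_mult_group)
  have 2: "hurwitz_equiv G (map (conjg G ?p) X @ Y @ ?o ?ks @ ?o ?ls)
      ((map (conjg G (inv (prodl G (?o ?L @ ?o ?ks')))) X @ Y) @ ?o (?ls @ ?ks'))"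
    using hurwitz_equiv_raise[OF sub letters(1) inv_closed[OF closed(1)] letters(2,3) one']
    unfolding ks' p' by (simp only: append_assoc map_append)
  have 3: "hurwitz_equiv G (?o (?ls @ ?ks'))
      (?o ([0..<g] @ [0..<g] @ [Suc j..<g+1] @ [Suc j..<g+1] @ replicate (2+2*Suc j) g))"
    using Suc.prems g by (intro hurwitz_equiv_permute_odd) auto
  have "hurwitz_equiv G (state 0)
      ((map (conjg G (inv (prodl G (?o ?L @ ?o ?ks')))) X @ Y)
        @ ?o ([0..<g] @ [0..<g] @ [Suc j..<g+1] @ [Suc j..<g+1] @ replicate (2+2*Suc j) g))"
    by (rule hurwitz_equiv_trans[OF IH hurwitz_equiv_trans[OF 1 hurwitz_equiv_trans[OF 2
      hurwitz_equiv_append[OF hurwitz_equiv_refl 3]]]])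
  then show ?case
    unfolding state[of "Suc j"] L' by (simp only: append_assoc)
qed simp

end

section \<open>From \<open>Hg\<close> to the target factorization\<close>

theorem theorem4p7:
  fixes G (structure) and g :: nat and c :: "nat \<Rightarrow> 'a"
  assumes "group G" and "g \<ge> 3" and "chain_twists G g c"
  shows "hurwitz_equiv_conj G (Hg g c) (target G g c) \<and>
         (\<exists>us vs. target G g c = us @ daisy_neg g c @ vs)"
proof
  note twists = assms(3)[unfolded chain_twists_def]
  define n where "n = 2*g+1"
  interpret braid_chain G n c
  proof (intro braid_chain.intro braid_chain_axioms.intro \<open>group G\<close>)
    fix i j
    show "c i \<in> carrier G" if "1 \<le> i" "i \<le> n"
      using twists that unfolding n_def by (meson atLeastAtMost_iff)
    show "c i \<otimes> c j = c j \<otimes> c i" if "1 \<le> i" "i + 1 < j" "j \<le> n"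
    proof -
      have "i \<in> {1..2*g+1}" "j \<in> {1..2*g+1}"
        using that unfolding n_def by auto
      then show ?thesis
        using twists that by blast
    qed
    show "c i \<otimes> c (i+1) \<otimes> c i = c (i+1) \<otimes> c i \<otimes> c (i+1)" if "1 \<le> i" "i < n"
    proof -
      have "i \<in> {1..2*g}"
        using that unfolding n_def by auto
      then show ?thesis
        using twists by blast
    qed
  qed
  let ?o = "map (\<lambda>k. c (2*k+1))"
  define A B where "A = map c [1..<2*g+2]" and "B = rev A"
  define D E where "D = map (\<lambda>k. dtw G c (2*k)) (rev [1..<g+1])"
    and "E = map (\<lambda>k. etw G c (2*k)) [1..<g+1]"
  define D' E' where "D' = map (\<lambda>k. dbar G c (2*k)) [1..<g+1]"
    and "E' = map (\<lambda>k. ebar G c (2*k)) (rev [1..<g+1])"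
  define P Q where "P = ?o [0..<g+1]" and "Q = ?o (rev [0..<g+1])"
  define X Y where "X = E' @ D" and "Y = D' @ E"
  have n: "2*g+1 \<le> n" and n1: "[1..<n+1] = [1..<2*g+2]"
    by (simp_all add: n_def)
  have sub: "set A \<subseteq> carrier G" "set B \<subseteq> carrier G" "set P \<subseteq> carrier G" "set Q \<subseteq> carrier G"
    by (auto simp: A_def B_def P_def Q_def n_def)
  have XY: "set X \<subseteq> carrier G" "set Y \<subseteq> carrier G"
    using twist_conjugates_closed by (auto simp: X_def Y_def D_def E_def D'_def E'_def n_def)
  have shift: "prodl G A \<otimes> c i = c (i+1) \<otimes> prodl G A"
    and shift': "prodl G B \<otimes> c (i+1) = c i \<otimes> prodl G B" if "1 \<le> i" "i < n" for i
    using prodl_chain_shift[OF that] prodl_rev_chain_shift[OF that] unfolding n1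
    by (simp_all add: A_def B_def)
  note closed = prodl_closed[OF sub(1)] prodl_closed[OF sub(2)] prodl_closed[OF sub(3)]
    prodl_closed[OF XY(2)]
  \<comment> \<open>\<open>B\<close> lowers the index by one and \<open>A\<close> raises it again.
    Only \<open>c 1\<close> has no lower neighbour; its commutation is one of the assumed
    relations.\<close>
  have central: "c i \<otimes> prodl G (A @ B) = prodl G (A @ B) \<otimes> c i" if "1 \<le> i" "i \<le> n" for i
  proof (cases "i = 1")
    case True
    then show ?thesis using twists by (simp add: A_def B_def)
  next
    case False
    define j where "j = i - 1"
    have j: "i = j + 1" "1 \<le> j" "j < n"
      using False that by (auto simp: j_def)
    have "prodl G A \<otimes> prodl G B \<otimes> c i = (prodl G A \<otimes> c j) \<otimes> prodl G B"
      using shift'[OF j(2,3)] closed j by (simp add: m_assoc)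
    also have "\<dots> = c i \<otimes> (prodl G A \<otimes> prodl G B)"
      using shift[OF j(2,3)] closed j by (simp add: m_assoc)
    finally show ?thesis
      using sub by (simp add: prodl_append)
  qed
  have "hurwitz_equiv G (B @ (A @ B)) ((A @ B) @ B)"
    using central sub by (intro hurwitz_equiv_commute) (auto simp: A_def B_def n_def)
  then have "hurwitz_equiv G (A @ (B @ (A @ B))) (A @ ((A @ B) @ B))"
    by (rule hurwitz_equiv_append[OF hurwitz_equiv_refl])
  then have H1: "hurwitz_equiv G (Hg g c) (A @ A @ B @ B)"
    by (simp add: Hg_def A_def B_def Let_def)
  \<comment> \<open>The two factors are sorted in opposite directions, so that the
    \<open>dbar\<close> and \<open>etw\<close> blocks meet and form \<open>Y\<close>; likewise
    \<open>X\<close> arises from \<open>B @ B\<close>.\<close>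
  have AA: "hurwitz_equiv G (A @ A) ((P @ D') @ (E @ P))"
    unfolding A_def P_def D'_def E_def
    by (intro hurwitz_equiv_append chain_to_odd_dbar chain_to_etw_odd n)
  have BB: "hurwitz_equiv G (B @ B) ((Q @ E') @ (D @ Q))"
    unfolding A_def B_def Q_def E'_def D_def
    by (intro hurwitz_equiv_append rev_chain_to_odd_ebar rev_chain_to_dtw_odd n)
  \<comment> \<open>As group elements, \<open>A @ A\<close> equals \<open>P @ Y @ P\<close>. The
    left side raises an index by two, and \<open>P\<close> commutes with the odd letters, so
    cancelling \<open>P\<close> leaves the shift to \<open>Y\<close>.\<close>
  have Y_shift: "prodl G Y \<otimes> c (2*k+1) = c (2*Suc k+1) \<otimes> prodl G Y" if "k < g" for k
  proof -
    let ?a = "c (2*k+1)" and ?b = "c (2*Suc k+1)"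
    have ab: "?a \<in> carrier G" "?b \<in> carrier G"
      using that by (auto simp: n_def)
    have comm: "prodl G P \<otimes> ?a = ?a \<otimes> prodl G P" "prodl G P \<otimes> ?b = ?b \<otimes> prodl G P"
      using that sub ab c_odd_commute[of k] c_odd_commute[of "Suc k"]
      by (auto simp: P_def n_def intro!: commute_prodl[symmetric])
    have "prodl G ((P @ D') @ (E @ P)) = prodl G (A @ A)"
      using hurwitz_equiv_prodl[OF AA] sub by simp
    then have AA': "prodl G A \<otimes> prodl G A = prodl G P \<otimes> (prodl G Y \<otimes> prodl G P)"
      using sub XY by (simp add: prodl_append Y_def m_assoc)
    have "prodl G A \<otimes> prodl G A \<otimes> ?a = prodl G A \<otimes> (c (2*k+2) \<otimes> prodl G A)"
      using closed ab shift[of "2*k+1"] that by (simp add: m_assoc n_def)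
    also have "\<dots> = ?b \<otimes> (prodl G A \<otimes> prodl G A)"
      using closed ab shift[of "2*k+2"] that by (simp add: n_def flip: m_assoc)
    finally have "prodl G P \<otimes> (prodl G Y \<otimes> (prodl G P \<otimes> ?a))
        = (?b \<otimes> prodl G P) \<otimes> (prodl G Y \<otimes> prodl G P)"
      unfolding AA' using closed ab by (simp add: m_assoc)
    then have "prodl G P \<otimes> ((prodl G Y \<otimes> ?a) \<otimes> prodl G P)
        = prodl G P \<otimes> ((?b \<otimes> prodl G Y) \<otimes> prodl G P)"
      unfolding comm(1) comm(2)[symmetric] using closed ab by (simp add: m_assoc)
    then show ?thesis
      using closed ab by simp
  qed
  have sH: "set (Hg g c) \<subseteq> carrier G"
    by (auto simp: Hg_def Let_def n_def)
  have "prodl G (Hg g c) = prodl G (A @ B) [^] (2::nat)"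
    using sub by (simp add: Hg_def A_def B_def Let_def prodl_append numeral_2_eq_2 m_assoc)
  also have "\<dots> = \<one>"
    using twists by (simp add: A_def B_def)
  finally have H_one: "prodl G (Hg g c) = \<one>" .
  have one_if: "prodl G ys = \<one>" if "hurwitz_equiv G (Hg g c) ys" for ys
    using hurwitz_equiv_prodl[OF that sH] H_one by simp
  have PQ: "hurwitz_equiv G (Q @ P) (P @ P)" "hurwitz_equiv G (P @ Q) (P @ P)"
    using hurwitz_equiv_permute_odd[of "rev [0..<g+1] @ [0..<g+1]" "[0..<g+1] @ [0..<g+1]"]
      hurwitz_equiv_permute_odd[of "[0..<g+1] @ rev [0..<g+1]" "[0..<g+1] @ [0..<g+1]"]
    unfolding P_def Q_def map_append by (auto simp: n_def simp del: upt_Suc)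
  note H1
  also have "A @ A @ B @ B = (A @ A) @ (B @ B)"
    by simp
  also note hurwitz_equiv_append[OF AA BB]
  also have "((P @ D') @ (E @ P)) @ ((Q @ E') @ (D @ Q)) = (P @ Y @ P @ Q) @ (X @ Q)"
    by (simp add: X_def Y_def)
  finally have H2: "hurwitz_equiv G (Hg g c) ((P @ Y @ P @ Q) @ (X @ Q))" .
  also have "hurwitz_equiv G \<dots> ((X @ Q) @ (P @ Y @ P @ Q))"
    using one_if[OF H2] sub XY by (intro hurwitz_equiv_cyclic) auto
  also have "\<dots> = (X @ (Q @ P)) @ (Y @ (P @ Q))"
    by simp
  also have "hurwitz_equiv G \<dots> ((X @ (P @ P)) @ (Y @ (P @ P)))"
    by (intro hurwitz_equiv_append hurwitz_equiv_refl PQ)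
  also have "hurwitz_equiv G \<dots>
      (((P @ P) @ map (conjg G (inv (prodl G (P @ P)))) X) @ (Y @ (P @ P)))"
    using sub XY
    by (intro hurwitz_equiv_append hurwitz_equiv_refl hurwitz_equiv_move_block_left_conjg) auto
  also have "\<dots> = (P @ P) @ (map (conjg G (inv (prodl G (P @ P)))) X @ Y @ P @ P)"
    by simp
  finally have H3: "hurwitz_equiv G (Hg g c) \<dots>" .
  have PP: "prodl G (P @ P) \<in> carrier G"
    using sub by (intro prodl_closed) auto
  note H3
  also have "hurwitz_equiv G ((P @ P) @ (map (conjg G (inv (prodl G (P @ P)))) X @ Y @ P @ P))
      ((map (conjg G (inv (prodl G (P @ P)))) X @ Y @ P @ P) @ (P @ P))"
    using one_if[OF H3] sub XY PP by (intro hurwitz_equiv_cyclic) auto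
  also have "\<dots> = (map (conjg G (inv (prodl G (P @ P)))) X @ Y)
      @ ?o ([0..<g+1] @ [0..<g+1] @ [0..<g+1] @ [0..<g+1])"
    by (simp add: P_def)
  \<comment> \<open>Of the four copies of each odd letter below \<open>c (2*g+1)\<close>, two rest
    and end up as the squares in the target, and two will be raised.\<close>
  also have "hurwitz_equiv G \<dots> ((map (conjg G (inv (prodl G (P @ P)))) X @ Y)
      @ ?o ([0..<g] @ [0..<g] @ [0..<g+1] @ [0..<g+1] @ replicate (2+2*0) g))"
    by (intro hurwitz_equiv_append[OF hurwitz_equiv_refl] hurwitz_equiv_permute_odd)
      (auto simp: n_def numeral_2_eq_2)
  finally have H4: "hurwitz_equiv G (Hg g c) \<dots>" .
  have pow4: "2*g+4 = Suc (Suc (2+2*g))"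
    by simp
  \<comment> \<open>The bound \<open>Suc j\<close> counts stage 0 as well: there \<open>X\<close> is
    already conjugated by the inverse of \<open>P @ P\<close>.\<close>
  define state where "state j =
      map (conjg G (inv (prodl G (?o
        (concat (map (\<lambda>i. [i..<g+1] @ [i..<g+1]) [0..<Suc j])))))) X @ Y @
      ?o ([0..<g] @ [0..<g] @ [j..<g+1] @ [j..<g+1] @ replicate (2+2*j) g)" for j
  have "?o (concat (map (\<lambda>i. [i..<g+1] @ [i..<g+1]) [0..<Suc 0])) = P @ P"
    by (simp add: P_def)
  then have H5: "hurwitz_equiv G (Hg g c) (state 0)"
    using H4 unfolding state_def by (simp only: append_assoc)
  also have "hurwitz_equiv G (state 0) (state g)"
    using one_if[OF H5] by (intro hurwitz_equiv_raise_odd[OF n XY Y_shift state_def]) auto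
  also have "state g = (map (conjg G (inv (phi G g c [^] (2::nat)))) X @ Y)
      @ ?o ([0..<g] @ [0..<g] @ [g] @ [g] @ replicate (2+2*g) g)"
    unfolding state_def Suc_eq_plus1 prodl_tails_eq_phi_square[OF n] by simp
  \<comment> \<open>The resting copies are paired into squares; the two tails, now just
    \<open>[g]\<close> each, bring the last exponent from 2+2g to 2g+4.\<close>
  also have "hurwitz_equiv G \<dots> ((map (conjg G (inv (phi G g c [^] (2::nat)))) X @ Y)
      @ ?o (concat (map (\<lambda>k. [k] @ [k]) [0..<g]) @ replicate (2*g+4) g))"
    unfolding pow4
    by (intro hurwitz_equiv_append[OF hurwitz_equiv_refl] hurwitz_equiv_permute_odd)
      (auto simp: n_def mset_concat_map_append simp del: append_Cons)
  also have "\<dots> = target G g c"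
  proof -
    have "?o (concat (map (\<lambda>k. [k] @ [k]) [0..<g]))
        = concat (map (\<lambda>k. [c (2*k-1), c (2*k-1)]) (map Suc [0..<g]))"
      by (simp add: map_concat o_def)
    also have "map Suc [0..<g] = [1..<g+1]"
      by (simp add: map_Suc_upt)
    finally show ?thesis
      by (simp add: target_def Let_def X_def Y_def D_def E_def D'_def E'_def o_def
          del: upt_Suc)
  qed
  finally show "hurwitz_equiv_conj G (Hg g c) (target G g c)"
    using sH by (intro hurwitz_equiv_conj_if_hurwitz_equiv)

  \<comment> \<open>The daisy subword starts after the square of \<open>c 1\<close> and takes 2g-2
    of the 2g+4 last letters, leaving six.\<close>
  have "[1..<g+1] = 1 # [2..<g+1]"
    using \<open>g \<ge> 3\<close> upt_conv_Cons[of 1 "g+1"] by (simp add: numeral_2_eq_2 del: upt_Suc)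
  moreover have "replicate (2*g+4) (c (2*g+1)) = replicate (2*g-2) (c (2*g+1)) @ replicate 6 (c (2*g+1))"
    using \<open>g \<ge> 3\<close> by (simp only: flip: replicate_add) simp
  ultimately have tail: "concat (map (\<lambda>k. [c (2*k-1), c (2*k-1)]) [1..<g+1])
      @ replicate (2*g+4) (c (2*g+1)) = [c 1, c 1] @ daisy_neg g c @ replicate 6 (c (2*g+1))"
    by (simp add: daisy_neg_def del: upt_Suc)
  show "\<exists>us vs. target G g c = us @ daisy_neg g c @ vs"
    unfolding target_def Let_def tail
    by (simp only: flip: append_assoc) blast
qed

end
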